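(* Consider the flux reconstruction (FR) semi-discretisation (see context) of $\partial_t u+\nabla\cdot(u\otimes\mathbf a)=0$ with velocity $\mathbf a=[a_{x_1},a_{x_2},\dots]^T$, with nodal solution $\mathbf u$ and linear nodal flux $\mathbf F=[a_{x_1},a_{x_2},\dots]^T\otimes\mathbf u$. Suppose that $$\mathbf W_\partial=\mathrm{diag}(\mathbf w_\partial)\quad\text{with all entries of }\mathbf w_\partial\text{ non-negative},$$ that the numerical fluxes at each interface flux point $j$ are, for $\kappa\in[0,1]$, $$(\mathbf n\cdot F)^{\mathrm{num}\,+}_j=\tfrac12(\mathbf n_j^+\cdot\mathbf a)(u_j^++u_j^-)-\tfrac12\kappa|\mathbf n_j^+\cdot\mathbf a|(u_j^--u_j^+),$$ $$(\mathbf n\cdot F)^{\mathrm{num}\,-}_j=\tfrac12(\mathbf n_j^-\cdot\mathbf a)(u_j^-+u_j^+)-\tfrac12\kappa|\mathbf n_j^-\cdot\mathbf a|(u_j^+-u_j^-),$$ that the matrix $\mathbf Q$ satisfies $$\mathbf Q-\mathbf Q^T=0,\qquad \mathbf Q\mathbf D_{x_i}+\mathbf D_{x_i}^T\mathbf Q^T=0\ \ \forall\, i\in\{1,\dots,d\},\qquad \mathbf v^T(\mathbf M+\mathbf Q)\mathbf v>0\ \ \forall\,\mathbf v\in\mathbb R^{N_s}\setminus\{0\},$$ and that the correction matrix is $$\mathbf C=(\mathbf M+\mathbf Q)^{-1}\mathbf L_\partial^T\mathbf W_\partial .$$ Then FR applied to this equation is stable in the norm induced by $\mathbf M+\mathbf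 Q$, i.e. $$\frac{\mathrm d}{\mathrm dt}\|\mathbf u\|^2_{M+Q}\le 0 .$$
   Context: Setting. The domain in $\mathbb R^d$ is divided into a conforming mesh of affine elements. On each element, $u$ is approximated by a polynomial of total degree at most $k$, represented by its vector $\mathbf u\in\mathbb R^{N_s}$ of values at $N_s$ solution points, with Lagrange basis $l_j$. The mass matrix $\mathbf M$ is defined by $\mathbf u^T\mathbf M\mathbf u=\int_{K_i}(\sum_j u_jl_j)^2\,\mathrm d\mathbf x$. The matrix $\mathbf D_{x_i}$ is the nodal differentiation matrix in direction $x_i$; $\mathbf D=[\mathbf D_{x_1},\mathbf D_{x_2},\dots]$ is the divergence matrix and $\mathbf G$ is the vertical stacking of $\mathbf D_{x_1},\mathbf D_{x_2},\dots$ (gradient matrix). Notation: $\hat{\mathbf A}=\mathbf I_d\otimes\mathbf A$. On the boundary of each element there are flux points; $\mathbf L_\partial$ interpolates nodal values to the flux points, $\mathbf W_\partial$ is the surface mass (quadrature) matrix, and $\mathbf N$ maps vector values at the flux points to their components along the outward unit normals. The operators satisfy the summation-by-parts property $\mathbf M\mathbf D+\mathbf G^T\hat{\mathbf M}=\mathbf L_\partial^T\mathbf W_\partial\mathbf N\hat{\mathbf L}_\partial$. FR scheme. On each element $$\frac{\mathrm d\mathbf u}{\mathrm dt}=-\mathbf D\mathbf F-\mathbf C\big[(\mathbf n\cdot\mathbf F)^{\mathrm{num}}-\mathbf N\hat{\mathbf L}_\partial\mathbf F\big],$$ where $\mathbf C$ is the correction matrix and $(\mathbf n\cdot\mathbf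 F)^{\mathrm{num}}$ is the vector of numerical normal fluxes at the element's flux points. Interfaces. At an interface flux point $j$, the superscripts $+$ and $-$ denote the two sides of the interface; $u_j^\pm$ are the values of the solution at $j$ interpolated from the two sides and $\mathbf n_j^\pm$ the respective outward normals, with $\mathbf n_j^+=-\mathbf n_j^-$. Norm. $\|\mathbf u\|^2_{M+Q}$ is $\mathbf u^T(\mathbf M+\mathbf Q)\mathbf u$, summed over the elements of the domain. *)

theory Defs
  imports "HOL-Analysis.Analysis"
begin

definition poly_space :: "nat \<Rightarrow> (real ^ 'd::finite \<Rightarrow> real) set" where
  "poly_space k = {p. \<exists>c :: ('d \<Rightarrow> nat) \<Rightarrow> real.
     p = (\<lambda>x. \<Sum>\<alpha>\<in>{\<alpha>. (\<Sum>i\<in>UNIV. \<alpha> i) \<le> k}. c \<alpha> * (\<Prod>i\<in>UNIV. x $ i ^ \<alpha> i))}"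

definition unisolvent :: "nat \<Rightarrow> ('s::finite \<Rightarrow> real ^ 'd) \<Rightarrow> bool" where
  "unisolvent k x \<longleftrightarrow> (\<forall>v :: real ^ 's. \<exists>!p. p \<in> poly_space k \<and> (\<forall>j. p (x j) = v $ j))"

definition lagrange :: "nat \<Rightarrow> ('s \<Rightarrow> real ^ 'd) \<Rightarrow> 's \<Rightarrow> real ^ 'd \<Rightarrow> real" where
  "lagrange k x j = (THE p. p \<in> poly_space k \<and> (\<forall>i. p (x i) = (if i = j then 1 else 0)))"

text \<open>The symmetric matrix of the quadratic form \<open>u \<mapsto> \<integral>\<^sub>K (\<Sum>\<^sub>j u\<^sub>j l\<^sub>j)\<^sup>2\<close>;
  see \<open>mass_matrix_unique\<close> below.\<close>

definition mass_matrix ::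
    "nat \<Rightarrow> (real ^ 'd) set \<Rightarrow> ('s::finite \<Rightarrow> real ^ 'd) \<Rightarrow> real ^ 's ^ 's" where
  "mass_matrix k K x = (\<chi> i j. integral K (\<lambda>z. lagrange k x i z * lagrange k x j z))"

definition partial_deriv :: "'d::finite \<Rightarrow> (real ^ 'd \<Rightarrow> real) \<Rightarrow> real ^ 'd \<Rightarrow> real" where
  "partial_deriv i p z = deriv (\<lambda>h. p (z + h *\<^sub>R axis i 1)) 0"

definition diff_matrix :: "nat \<Rightarrow> ('s::finite \<Rightarrow> real ^ 'd::finite) \<Rightarrow> 'd \<Rightarrow> real ^ 's ^ 's" where
  "diff_matrix k x i = (\<chi> a b. partial_deriv i (lagrange k x b) (x a))"

definition hstack :: "('d::finite \<Rightarrow> real ^ 's ^ 's) \<Rightarrow> real ^ ('d \<times> 's) ^ 's" where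
  "hstack A = (\<chi> a p. A (fst p) $ a $ snd p)"

definition vstack :: "('d::finite \<Rightarrow> real ^ 's ^ 's) \<Rightarrow> real ^ 's ^ ('d \<times> 's)" where
  "vstack A = (\<chi> p b. A (fst p) $ snd p $ b)"

definition kron ::
    "real ^ 'n ^ 'm \<Rightarrow> real ^ 'q ^ 'p \<Rightarrow> real ^ ('n \<times> 'q) ^ ('m \<times> 'p)" where
  "kron A B = (\<chi> r c. A $ fst r $ fst c * B $ snd r $ snd c)"

definition kron_vec :: "real ^ 'm \<Rightarrow> real ^ 'p \<Rightarrow> real ^ ('m \<times> 'p)" where
  "kron_vec a u = (\<chi> r. a $ fst r * u $ snd r)"

definition hat :: "real ^ 'q ^ 'p \<Rightarrow> real ^ ('d::finite \<times> 'q) ^ ('d \<times> 'p)" where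
  "hat A = kron (mat 1) A"

definition diag_matrix :: "real ^ 'n \<Rightarrow> real ^ 'n ^ 'n" where
  "diag_matrix w = (\<chi> i j. if i = j then w $ i else 0)"

text \<open>Conformity: two distinct elements meet in a (possibly empty) common face.\<close>

definition conforming_mesh :: "('e \<Rightarrow> (real ^ 'd) set) \<Rightarrow> bool" where
  "conforming_mesh K \<longleftrightarrow>
     (\<forall>e. polytope (K e) \<and> interior (K e) \<noteq> {}) \<and>
     (\<forall>e e'. e \<noteq> e' \<longrightarrow>
        interior (K e) \<inter> interior (K e') = {} \<and>
        (K e \<inter> K e') face_of K e \<and> (K e \<inter> K e') face_of K e')"

text \<open>The flux points of all elements are collected in one index type \<open>'f\<close>: an index is a
  flux point together with the element \<open>own f\<close> and the facet of that element it is seen from,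
  so a geometric point on an interface carries one index for each side. This allows the number of
  flux points to depend on the element. The position of \<open>f\<close> is \<open>y f\<close> and
  \<open>n f\<close> is the outward unit normal of the facet.\<close>

definition facet_at :: "(real ^ 'd) set \<Rightarrow> real ^ 'd \<Rightarrow> real ^ 'd \<Rightarrow> (real ^ 'd) set" where
  "facet_at K y n = {z \<in> K. n \<bullet> z = n \<bullet> y}"

definition boundary_point_with_normal ::
    "(real ^ 'd) set \<Rightarrow> real ^ 'd \<Rightarrow> real ^ 'd \<Rightarrow> bool" where
  "boundary_point_with_normal K y n \<longleftrightarrow>
     y \<in> K \<and> norm n = 1 \<and> (\<forall>z\<in>K. n \<bullet> z \<le> n \<bullet> y) \<and> facet_at K y n facet_of K"

text \<open>The map \<open>opp\<close> sends a flux point to the flux point on the other side of its interface.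
  It is total, i.e. the domain has no physical boundary: a facet shared by two elements is
  matched with itself, and the facets on the boundary of the union of the elements are matched
  with each other by a translation (periodicity). As the mesh is conforming, the two sides of an
  interface carry the same surface quadrature.\<close>

definition matching_interfaces ::
    "('e \<Rightarrow> (real ^ 'd) set) \<Rightarrow> ('f::finite \<Rightarrow> 'e) \<Rightarrow> ('f \<Rightarrow> real ^ 'd) \<Rightarrow> ('f \<Rightarrow> real ^ 'd) \<Rightarrow>
     ('f \<Rightarrow> 'f) \<Rightarrow> real ^ 'f \<Rightarrow> bool" where
  "matching_interfaces K own y n opp w \<longleftrightarrow>
     (\<forall>f. boundary_point_with_normal (K (own f)) (y f) (n f)) \<and>
     (\<forall>f. opp (opp f) = f \<and> n (opp f) = - n f \<and> w $ opp f = w $ f \<and>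
          facet_at (K (own (opp f))) (y (opp f)) (n (opp f)) =
            (\<lambda>z. z + (y (opp f) - y f)) ` facet_at (K (own f)) (y f) (n f)) \<and>
     (\<forall>f e'. e' \<noteq> own f \<and> facet_at (K (own f)) (y f) (n f) \<subseteq> K e' \<longrightarrow>
          own (opp f) = e' \<and> y (opp f) = y f)"

text \<open>Interpolation from the nodes of \<open>e\<close> to the flux points of \<open>e\<close>. The rows of flux points of
  other elements are zero; hence in \<open>L\<^sup>T W N (hat L)\<close> and \<open>L\<^sup>T W\<close> with mesh-wide \<open>W\<close> and \<open>N\<close>
  only the flux points of \<open>e\<close> contribute.\<close>

definition interp_matrix ::
    "nat \<Rightarrow> ('f::finite \<Rightarrow> 'e) \<Rightarrow> ('f \<Rightarrow> real ^ 'd) \<Rightarrow> ('e \<Rightarrow> 's::finite \<Rightarrow> real ^ 'd) \<Rightarrow> 'e \<Rightarrow> real ^ 's ^ 'f"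
  where
  "interp_matrix k own y x e =
     (\<chi> f j. if own f = e then lagrange k (x e) j (y f) else 0)"

definition normal_matrix :: "('f::finite \<Rightarrow> real ^ 'd) \<Rightarrow> real ^ ('d \<times> 'f) ^ 'f" where
  "normal_matrix n = (\<chi> f p. if snd p = f then n f $ fst p else 0)"

definition mesh_norm_sq :: "('e::finite \<Rightarrow> real ^ 's ^ 's) \<Rightarrow> ('e \<Rightarrow> real ^ 's) \<Rightarrow> real" where
  "mesh_norm_sq A u = (\<Sum>e\<in>UNIV. u e \<bullet> (A e *v u e))"

lemma poly_space_continuous:
  assumes "p \<in> poly_space k"
  shows "continuous_on S p"
  using assms by (auto simp: poly_space_def intro!: continuous_intros)

lemma lagrange_in_poly_space:
  fixes x :: "'s::finite \<Rightarrow> real ^ 'd"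
  assumes "unisolvent k x"
  shows "lagrange k x j \<in> poly_space k" "lagrange k x j (x i) = (if i = j then 1 else 0)"
proof -
  have "\<exists>!p. p \<in> poly_space k \<and> (\<forall>i. p (x i) = (\<chi> i. if i = j then 1 else 0) $ i)"
    using assms unfolding unisolvent_def by blast
  then have "\<exists>!p. p \<in> poly_space k \<and> (\<forall>i. p (x i) = (if i = j then 1 else 0))"
    by simp
  from theI'[OF this] show "lagrange k x j \<in> poly_space k"
    "lagrange k x j (x i) = (if i = j then 1 else 0)"
    unfolding lagrange_def by auto
qed

lemma mass_matrix_quadratic_form:
  fixes x :: "'s::finite \<Rightarrow> real ^ 'd" and u :: "real ^ 's"
  assumes "polytope K" "unisolvent k x"
  shows "u \<bullet> (mass_matrix k K x *v u) = integral K (\<lambda>z. (\<Sum>j\<in>UNIV. u $ j * lagrange k x j z)\<^sup>2)"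
proof -
  let ?l = "lagrange k x"
  have int: "(\<lambda>z. c * (?l i z * ?l j z)) integrable_on K" for c i j
  proof -
    have "continuous_on K (\<lambda>z. c * (?l i z * ?l j z))"
      by (intro continuous_intros poly_space_continuous[OF lagrange_in_poly_space(1)[OF assms(2)]])
    then have "set_integrable lborel K (\<lambda>z. c * (?l i z * ?l j z))"
      unfolding set_integrable_def
      by (rule borel_integrable_compact[OF polytope_imp_compact[OF assms(1)]])
    then show ?thesis
      by (rule set_borel_integral_eq_integral(1))
  qed
  have "integral K (\<lambda>z. (\<Sum>j\<in>UNIV. u $ j * ?l j z)\<^sup>2)
      = integral K (\<lambda>z. \<Sum>i\<in>UNIV. \<Sum>j\<in>UNIV. (u $ i * u $ j) * (?l i z * ?l j z))"
    by (simp add: power2_eq_square sum_product mult_ac)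
  also have "\<dots> = (\<Sum>i\<in>UNIV. \<Sum>j\<in>UNIV. u $ i * u $ j * integral K (\<lambda>z. ?l i z * ?l j z))"
    by (subst integral_sum; (intro integrable_sum int)?; simp add: integral_sum int)
  also have "\<dots> = u \<bullet> (mass_matrix k K x *v u)"
    by (simp add: inner_vec_def matrix_vector_mult_def mass_matrix_def sum_distrib_left mult_ac)
  finally show ?thesis by simp
qed

lemma mass_matrix_symmetric: "transpose (mass_matrix k K x) = mass_matrix k K x"
  by (simp add: mass_matrix_def transpose_def mult.commute)

lemma mass_matrix_unique:
  fixes x :: "'s::finite \<Rightarrow> real ^ 'd" and A :: "real ^ 's ^ 's"
  assumes "polytope K" "unisolvent k x" and A: "transpose A = A"
    and q: "\<And>u. u \<bullet> (A *v u) = integral K (\<lambda>z. (\<Sum>j\<in>UNIV. u $ j * lagrange k x j z)\<^sup>2)"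
  shows "A = mass_matrix k K x"
proof -
  let ?B = "A - mass_matrix k K x"
  have sym: "v \<bullet> (?B *v u) = u \<bullet> (?B *v v)" for u v
  proof -
    have "transpose ?B = ?B"
      using A mass_matrix_symmetric[of k K x] by (simp add: transpose_def vec_eq_iff)
    then show ?thesis
      by (metis dot_lmul_matrix inner_commute vector_transpose_matrix)
  qed
  have zero: "u \<bullet> (?B *v u) = 0" for u
    using q[of u] mass_matrix_quadratic_form[OF assms(1,2), of u]
    by (simp add: matrix_vector_mult_diff_rdistrib inner_diff_right)
  have "u \<bullet> (?B *v v) = 0" for u v
    using zero[of "u + v"] zero[of u] zero[of v] sym[of u v]
    by (simp add: matrix_vector_right_distrib inner_add_left inner_add_right)
  then have "?B *v v = 0 *v v" for v
    by (metis inner_eq_zero_iff matrix_vector_mult_0)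
  then have "?B = 0"
    by (simp add: matrix_eq)
  then show ?thesis by simp
qed

end

theory Submission
  imports Defs
begin

text \<open>Write \<open>P = M + Q\<close>. As \<open>P C = L\<^sup>T W\<close>, the correction matrix makes the rate of
  \<open>u\<^sup>T P u\<close> on an element equal to \<open>-2 u\<^sup>T P D F\<close> plus a boundary term. Here \<open>Q D\<^sub>i\<close> is
  skew-symmetric and does not contribute, and summation by parts turns \<open>2 u\<^sup>T M D F\<close> into a
  boundary term as well. Summed over the elements, the rate is a weighted sum over the flux points,
  in which the central part of the flux cancels between the two sides of each interface and the
  upwind part leaves \<open>-\<kappa>/2 \<Sum> w \<bar>n \<bullet> a\<bar> (u\<^sup>+ - u\<^sup>-)\<^sup>2\<close> over the flux points.\<close>

lemma inner_matrix_vector_transpose: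
  fixes A :: "real ^ 'n ^ 'm"
  shows "v \<bullet> (A *v u) = (transpose A *v v) \<bullet> u"
  by (metis dot_lmul_matrix vector_transpose_matrix transpose_transpose)

text \<open>A quadratic form takes the same values for a matrix and its transpose, so here it equals
  its own negative.\<close>

lemma skew_inner_eq_0:
  fixes B :: "real ^ 'n ^ 'n"
  assumes "B + transpose B = 0"
  shows "v \<bullet> (B *v v) = 0"
proof -
  have "v \<bullet> (B *v v) + v \<bullet> (transpose B *v v) = 0"
    using assms by (metis inner_add_right inner_zero_right matrix_vector_mult_0
        matrix_vector_mult_add_rdistrib)
  moreover have "v \<bullet> (transpose B *v v) = v \<bullet> (B *v v)"
    by (metis inner_commute inner_matrix_vector_transpose transpose_transpose)
  ultimately show ?thesis by simp
qed

text \<open>Positivity rules out a nonzero kernel vector, and a square matrix with trivial kernel is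
  invertible. This is what allows \<open>M + Q\<close> to cancel the inverse inside the correction
  matrix.\<close>

lemma pos_def_mult_matrix_inv:
  fixes A :: "real ^ 'n ^ 'n"
  assumes "\<And>v. v \<noteq> 0 \<Longrightarrow> v \<bullet> (A *v v) > 0"
  shows "A ** matrix_inv A = mat 1"
proof -
  have "\<forall>v. A *v v = 0 \<longrightarrow> v = 0"
    using assms by (metis inner_zero_right less_irrefl)
  then have "invertible A"
    by (simp add: invertible_left_inverse matrix_left_invertible_ker)
  then show ?thesis
    unfolding invertible_def matrix_inv_def by (rule someI2_ex) blast
qed

text \<open>The product rule yields two terms; symmetry of \<open>A\<close> makes them equal, whence
  the factor 2.\<close>

lemma has_real_derivative_quadratic_form:
  fixes A :: "real ^ 'n ^ 'n"
  assumes "transpose A = A" and u: "(u has_vector_derivative u') (at t within T)"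
  shows "((\<lambda>t. u t \<bullet> (A *v u t)) has_real_derivative 2 * (u t \<bullet> (A *v u'))) (at t within T)"
proof -
  have "((\<lambda>t. A *v u t) has_vector_derivative A *v u') (at t within T)"
    by (rule bounded_linear.has_vector_derivative[OF matrix_vector_mul_bounded_linear u])
  from bounded_bilinear.has_vector_derivative[OF bounded_bilinear_inner u this]
  have "((\<lambda>t. u t \<bullet> (A *v u t)) has_vector_derivative u t \<bullet> (A *v u') + u' \<bullet> (A *v u t))
    (at t within T)" .
  moreover have "u' \<bullet> (A *v u t) = u t \<bullet> (A *v u')"
    using assms(1) by (metis inner_commute inner_matrix_vector_transpose)
  ultimately show ?thesis
    by (simp add: has_real_derivative_iff_has_vector_derivative)
qed

lemma sum_UNIV_pair:
  "(\<Sum>p\<in>UNIV. f p) = (\<Sum>i\<in>UNIV. \<Sum>j\<in>UNIV. f (i :: 'a::finite, j :: 'b::finite))"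
  by (simp add: sum.cartesian_product case_prod_unfold flip: UNIV_Times_UNIV)

text \<open>For the linear flux the divergence is a combination of directional derivatives, so
  properties known per direction carry over to the stacked operators.\<close>

lemma inner_hstack_kron_vec:
  "v \<bullet> (hstack A *v kron_vec a u) = (\<Sum>i\<in>UNIV. a $ i * (v \<bullet> (A i *v u)))"
proof -
  have "hstack A *v kron_vec a u = (\<Sum>i\<in>UNIV. a $ i *\<^sub>R (A i *v u))"
    by (simp add: vec_eq_iff hstack_def kron_vec_def matrix_vector_mult_def sum_UNIV_pair
        sum_distrib_left mult_ac)
  then show ?thesis
    by (simp add: inner_sum_right)
qed

lemma matrix_mult_hstack: "M ** hstack A = hstack (\<lambda>i. M ** A i)"
  by (simp add: vec_eq_iff hstack_def matrix_matrix_mult_def)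

lemma sum_mat_1_mult:
  fixes i :: "'d::finite"
  shows "(\<Sum>j\<in>UNIV. (mat 1 :: real ^ 'd ^ 'd) $ i $ j * h j) = h i"
    "(\<Sum>j\<in>UNIV. (mat 1 :: real ^ 'd ^ 'd) $ j $ i * h j) = h i"
  by (simp_all add: mat_def mult_delta_left mult_delta_right)

text \<open>\<open>hat M\<close> is block diagonal and acts on each direction separately. This
  brings the second summand of summation by parts into the same stacked form as the first.\<close>

lemma transpose_vstack_mult_hat:
  fixes A :: "'d::finite \<Rightarrow> real ^ 's ^ 's"
  shows "transpose (vstack A) ** hat M = hstack (\<lambda>i. transpose (A i) ** M)"
proof -
  have "(\<Sum>j\<in>UNIV. \<Sum>q\<in>UNIV. A j $ q $ b * ((mat 1 :: real ^ 'd ^ 'd) $ j $ i * M $ q $ c))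
      = (\<Sum>q\<in>UNIV. A i $ q $ b * M $ q $ c)" for i :: 'd and b c
    by (simp add: mult.left_commute sum_mat_1_mult flip: sum_distrib_left)
  then show ?thesis
    by (simp add: vec_eq_iff hstack_def vstack_def hat_def kron_def transpose_def
        matrix_matrix_mult_def sum_UNIV_pair)
qed

text \<open>An instance of the mixed-product rule for Kronecker products: interpolating the linear
  flux gives the flux of the interpolated solution.\<close>

lemma hat_mult_kron_vec:
  fixes a :: "real ^ 'd::finite"
  shows "hat B *v kron_vec a u = kron_vec a (B *v u)"
proof -
  have "(\<Sum>i\<in>UNIV. \<Sum>j\<in>UNIV. (mat 1 :: real ^ 'd ^ 'd) $ r $ i * B $ s $ j * (a $ i * u $ j))
      = a $ r * (\<Sum>j\<in>UNIV. B $ s $ j * u $ j)" for r :: 'd and s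
  proof -
    have "(\<Sum>j\<in>UNIV. (mat 1 :: real ^ 'd ^ 'd) $ r $ i * B $ s $ j * (a $ i * u $ j))
        = (mat 1 :: real ^ 'd ^ 'd) $ r $ i * (a $ i * (\<Sum>j\<in>UNIV. B $ s $ j * u $ j))" for i
      by (simp add: sum_distrib_left mult_ac)
    then show ?thesis by (simp add: sum_mat_1_mult)
  qed
  then show ?thesis
    by (simp add: vec_eq_iff hat_def kron_def kron_vec_def matrix_vector_mult_def sum_UNIV_pair)
qed

lemma normal_matrix_mult_kron_vec: "(normal_matrix n *v kron_vec a v) $ f = (n f \<bullet> a) * v $ f"
  by (simp add: normal_matrix_def kron_vec_def matrix_vector_mult_def sum_UNIV_pair inner_vec_def
      mult_delta_left mult_delta_right sum_distrib_left mult_ac)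

lemma inner_diag_matrix: "v \<bullet> (diag_matrix w *v z) = (\<Sum>f\<in>UNIV. w $ f * v $ f * z $ f)"
  by (simp add: inner_vec_def diag_matrix_def matrix_vector_mult_def mult_delta_left mult_delta_right
      mult_ac)

text \<open>The numerical flux \<open>g\<close> stays arbitrary here: the coupling between elements
  enters only when the boundary terms are summed over the mesh.\<close>

lemma element_energy_rate:
  fixes M Q :: "real ^ 's ^ 's" and A :: "'d::finite \<Rightarrow> real ^ 's ^ 's" and L :: "real ^ 's ^ 'f::finite"
    and g :: "real ^ 'f" and u :: "real ^ 's" and a :: "real ^ 'd"
  assumes M: "transpose M = M"
    and SBP: "M ** hstack A + transpose (vstack A) ** hat M
      = transpose L ** diag_matrix w ** normal_matrix n ** hat L"
    and skew: "\<And>i. Q ** A i + transpose (A i) ** transpose Q = 0"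
    and C: "(M + Q) ** C = transpose L ** diag_matrix w"
  defines "F \<equiv> kron_vec a u"
  shows "2 * (u \<bullet> ((M + Q) *v (- (hstack A *v F) - C *v (g - normal_matrix n *v (hat L *v F)))))
    = (\<Sum>f\<in>UNIV. w $ f * ((n f \<bullet> a) * ((L *v u) $ f)\<^sup>2 - 2 * (L *v u) $ f * g $ f))"
proof -
  let ?z = "L *v u" and ?N = "normal_matrix n *v (hat L *v F)"
  have N: "?N $ f = (n f \<bullet> a) * ?z $ f" for f
    by (simp add: F_def hat_mult_kron_vec normal_matrix_mult_kron_vec)
  have bdry: "u \<bullet> ((transpose L ** diag_matrix w) *v v) = (\<Sum>f\<in>UNIV. w $ f * ?z $ f * v $ f)" for v
    by (metis inner_diag_matrix inner_matrix_vector_transpose matrix_vector_mul_assoc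
        transpose_transpose)
  have "u \<bullet> (Q *v (hstack A *v F)) = (\<Sum>i\<in>UNIV. a $ i * (u \<bullet> ((Q ** A i) *v u)))"
    by (simp add: F_def matrix_vector_mul_assoc matrix_mult_hstack inner_hstack_kron_vec)
  also have "\<dots> = 0"
    using skew by (intro sum.neutral) (simp add: skew_inner_eq_0 matrix_transpose_mul)
  finally have QD: "u \<bullet> (Q *v (hstack A *v F)) = 0" .
  \<comment> \<open>As \<open>M\<close> is symmetric, these two matrices are transposes of each
    other, so both summands of summation by parts contribute equally to the energy.\<close>
  have "u \<bullet> ((transpose (A i) ** M) *v u) = u \<bullet> ((M ** A i) *v u)" for i
    by (metis M inner_commute inner_matrix_vector_transpose matrix_transpose_mul transpose_transpose)
  then have "u \<bullet> ((transpose (vstack A) ** hat M) *v F) = u \<bullet> ((M ** hstack A) *v F)"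
    by (simp add: F_def transpose_vstack_mult_hat matrix_mult_hstack inner_hstack_kron_vec)
  then have "2 * (u \<bullet> (M *v (hstack A *v F)))
      = u \<bullet> ((M ** hstack A + transpose (vstack A) ** hat M) *v F)"
    by (simp add: matrix_vector_mult_add_rdistrib inner_add_right matrix_vector_mul_assoc)
  also have "\<dots> = u \<bullet> ((transpose L ** diag_matrix w) *v ?N)"
    by (simp add: SBP matrix_vector_mul_assoc matrix_mul_assoc)
  finally have MD: "2 * (u \<bullet> (M *v (hstack A *v F))) = (\<Sum>f\<in>UNIV. w $ f * ?z $ f * ?N $ f)"
    by (simp add: bdry)
  have "u \<bullet> ((M + Q) *v (C *v (g - ?N))) = (\<Sum>f\<in>UNIV. w $ f * ?z $ f * (g - ?N) $ f)"
    by (simp only: matrix_vector_mul_assoc C bdry)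
  moreover have "(M + Q) *v (- (hstack A *v F) - C *v (g - ?N))
      = - (M *v (hstack A *v F)) - Q *v (hstack A *v F) - (M + Q) *v (C *v (g - ?N))"
    by (simp add: matrix_vector_mult_diff_distrib matrix_vector_mult_add_rdistrib
        linear_neg[OF matrix_vector_mul_linear])
  ultimately have "2 * (u \<bullet> ((M + Q) *v (- (hstack A *v F) - C *v (g - ?N))))
      = - (\<Sum>f\<in>UNIV. w $ f * ?z $ f * ?N $ f) - 2 * (\<Sum>f\<in>UNIV. w $ f * ?z $ f * (g - ?N) $ f)"
    using QD MD by (simp add: inner_diff_right)
  \<comment> \<open>With \<open>b = n f \<bullet> a\<close>, the volume term gives
    \<open>- b z^2\<close> and the subtracted interior flux in the correction gives
    \<open>2 b z^2\<close>, leaving \<open>b z^2\<close>.\<close>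
  also have "\<dots> = (\<Sum>f\<in>UNIV. w $ f * ((n f \<bullet> a) * (?z $ f)\<^sup>2 - 2 * ?z $ f * g $ f))"
    by (simp add: sum_distrib_left N algebra_simps power2_eq_square flip: sum_negf sum_subtractf)
  finally show ?thesis .
qed

lemma interp_matrix_mult_eq_0:
  "own f \<noteq> e \<Longrightarrow> (interp_matrix k own y x e *v u) $ f = 0"
  by (simp add: interp_matrix_def matrix_vector_mult_def)

text \<open>Adding the terms of \<open>f\<close> and \<open>opp f\<close>, the part
  \<open>b (v^2 - v'^2)\<close> cancels against the central flux contribution
  \<open>- b (v + v') (v - v')\<close>; only the upwind square survives.\<close>

lemma interface_energy_nonpos:
  fixes opp :: "'f::finite \<Rightarrow> 'f" and w b v g :: "'f \<Rightarrow> real"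
  assumes opp: "\<And>f. opp (opp f) = f" "\<And>f. w (opp f) = w f" "\<And>f. b (opp f) = - b f"
    and pos: "\<And>f. 0 \<le> w f" "0 \<le> \<kappa>"
    and g: "\<And>f. g f = 1/2 * b f * (v f + v (opp f)) - 1/2 * \<kappa> * \<bar>b f\<bar> * (v (opp f) - v f)"
  shows "(\<Sum>f\<in>UNIV. w f * (b f * (v f)\<^sup>2 - 2 * v f * g f)) \<le> 0"
proof -
  let ?h = "\<lambda>f. w f * (b f * (v f)\<^sup>2 - 2 * v f * g f)"
  have "bij opp"
    using opp(1) by (rule involuntory_imp_bij)
  then have "(\<Sum>f\<in>UNIV. ?h f) = (\<Sum>f\<in>UNIV. ?h (opp f))"
    by (rule sum.reindex_bij_betw[symmetric])
  \<comment> \<open>Doubling counts each interface from both sides, which avoids choosing one side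
    as \<open>+\<close>.\<close>
  then have "2 * (\<Sum>f\<in>UNIV. ?h f) = (\<Sum>f\<in>UNIV. ?h f + ?h (opp f))"
    by (simp add: sum.distrib)
  also have "\<dots> = (\<Sum>f\<in>UNIV. - (w f * \<kappa> * \<bar>b f\<bar> * (v f - v (opp f))\<^sup>2))"
    by (rule sum.cong) (simp_all add: g opp power2_eq_square field_simps)
  also have "\<dots> \<le> 0"
    using pos by (intro sum_nonpos) simp
  finally show ?thesis by simp
qed

theorem lemma3p2:
  fixes k :: nat
    and K :: "'e::finite \<Rightarrow> (real ^ 'd) set"
    and x :: "'e \<Rightarrow> 's::finite \<Rightarrow> real ^ 'd"
    and own :: "'f::finite \<Rightarrow> 'e" and opp :: "'f \<Rightarrow> 'f" and y n :: "'f \<Rightarrow> real ^ 'd"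
    and w :: "real ^ 'f"
    and M :: "'e \<Rightarrow> real ^ 's ^ 's" and Dx :: "'e \<Rightarrow> 'd \<Rightarrow> real ^ 's ^ 's"
    and D :: "'e \<Rightarrow> real ^ ('d \<times> 's) ^ 's" and G :: "'e \<Rightarrow> real ^ 's ^ ('d \<times> 's)"
    and L :: "'e \<Rightarrow> real ^ 's ^ 'f" and W :: "real ^ 'f ^ 'f" and N :: "real ^ ('d \<times> 'f) ^ 'f"
    and Q :: "'e \<Rightarrow> real ^ 's ^ 's" and C :: "'e \<Rightarrow> real ^ 'f ^ 's"
    and a :: "real ^ 'd" and \<kappa> :: real and T :: "real set"
    and u :: "'e \<Rightarrow> real \<Rightarrow> real ^ 's" and F :: "'e \<Rightarrow> real \<Rightarrow> real ^ ('d \<times> 's)"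
    and uf :: "'f \<Rightarrow> real \<Rightarrow> real" and nF :: "real \<Rightarrow> real ^ 'f"
  assumes mesh: "conforming_mesh K"
    and nodes: "\<And>e j. x e j \<in> K e" "\<And>e. unisolvent k (x e)"
    and interfaces: "matching_interfaces K own y n opp w"
    and M: "\<And>e. M e = mass_matrix k (K e) (x e)"
    and Dx: "\<And>e i. Dx e i = diff_matrix k (x e) i"
    and D: "\<And>e. D e = hstack (Dx e)"
    and G: "\<And>e. G e = vstack (Dx e)"
    and L: "\<And>e. L e = interp_matrix k own y x e"
    and N: "N = normal_matrix n"
    and SBP: "\<And>e. M e ** D e + transpose (G e) ** hat (M e) = transpose (L e) ** W ** N ** hat (L e)"
    and W: "W = diag_matrix w" "\<And>f. 0 \<le> w $ f"
    and Q: "\<And>e. Q e - transpose (Q e) = 0"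
      "\<And>e i. Q e ** Dx e i + transpose (Dx e i) ** transpose (Q e) = 0"
      "\<And>e v. v \<noteq> 0 \<Longrightarrow> v \<bullet> ((M e + Q e) *v v) > 0"
    and C: "\<And>e. C e = matrix_inv (M e + Q e) ** transpose (L e) ** W"
    and T: "is_interval T"
    and F: "\<And>e t. t \<in> T \<Longrightarrow> F e t = kron_vec a (u e t)"
    and uf: "\<And>f t. t \<in> T \<Longrightarrow> uf f t = (L (own f) *v u (own f) t) $ f"
    and \<kappa>: "\<kappa> \<in> {0..1}"
    and flux_plus: "\<And>f t. t \<in> T \<Longrightarrow> nF t $ f =
        1/2 * (n f \<bullet> a) * (uf f t + uf (opp f) t)
      - 1/2 * \<kappa> * \<bar>n f \<bullet> a\<bar> * (uf (opp f) t - uf f t)"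
    and flux_minus: "\<And>f t. t \<in> T \<Longrightarrow> nF t $ opp f =
        1/2 * (n (opp f) \<bullet> a) * (uf (opp f) t + uf f t)
      - 1/2 * \<kappa> * \<bar>n (opp f) \<bullet> a\<bar> * (uf f t - uf (opp f) t)"
    and FR: "\<And>e t. t \<in> T \<Longrightarrow>
      (u e has_vector_derivative
         - (D e *v F e t) - C e *v (nF t - N *v (hat (L e) *v F e t))) (at t within T)"
  shows "\<forall>t\<in>T. \<exists>E. ((\<lambda>t. mesh_norm_sq (\<lambda>e. M e + Q e) (\<lambda>e. u e t)) has_real_derivative E)
           (at t within T) \<and> E \<le> 0"
proof
  fix t assume t: "t \<in> T"
  let ?u' = "\<lambda>e. - (D e *v F e t) - C e *v (nF t - N *v (hat (L e) *v F e t))"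
  let ?z = "\<lambda>e f. (L e *v u e t) $ f"
  let ?r = "\<lambda>f v. w $ f * ((n f \<bullet> a) * v\<^sup>2 - 2 * v * nF t $ f)"
  have sym: "transpose (M e) = M e" for e
    by (simp add: M mass_matrix_symmetric)
  have "transpose (M e + Q e) = M e + Q e" for e
    using sym[of e] Q(1)[of e] by (simp add: transpose_def vec_eq_iff)
  then have deriv: "((\<lambda>t. mesh_norm_sq (\<lambda>e. M e + Q e) (\<lambda>e. u e t)) has_real_derivative
      (\<Sum>e\<in>UNIV. 2 * (u e t \<bullet> ((M e + Q e) *v ?u' e)))) (at t within T)"
    unfolding mesh_norm_sq_def
    by (intro DERIV_sum has_real_derivative_quadratic_form FR t)
  have "(M e + Q e) ** C e = transpose (L e) ** diag_matrix w" for e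
    using pos_def_mult_matrix_inv[OF Q(3)[where e = e]] by (simp add: C W matrix_mul_assoc)
  then have "2 * (u e t \<bullet> ((M e + Q e) *v ?u' e)) = (\<Sum>f\<in>UNIV. ?r f (?z e f))" for e
    unfolding D F[OF t] N
    by (rule element_energy_rate[OF sym SBP[of e, unfolded D G W(1) N] Q(2)])
  then have "(\<Sum>e\<in>UNIV. 2 * (u e t \<bullet> ((M e + Q e) *v ?u' e)))
      = (\<Sum>e\<in>UNIV. \<Sum>f\<in>UNIV. ?r f (?z e f))"
    by (rule sum.cong[OF refl])
  \<comment> \<open>Regrouping by flux point prepares the pairing across interfaces; for each
    \<open>f\<close> only the element \<open>own f\<close> contributes, since the other
    interpolation rows vanish.\<close>
  also have "\<dots> = (\<Sum>f\<in>UNIV. \<Sum>e\<in>UNIV. ?r f (?z e f))"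
    by (rule sum.swap)
  also have "\<dots> = (\<Sum>f\<in>UNIV. ?r f (uf f t))"
  proof (rule sum.cong[OF refl])
    fix f
    have "?r f (?z e f) = (if own f = e then ?r f (uf f t) else 0)" for e
      by (auto simp: uf[OF t] L interp_matrix_mult_eq_0)
    then show "(\<Sum>e\<in>UNIV. ?r f (?z e f)) = ?r f (uf f t)" by simp
  qed
  \<comment> \<open>Here \<open>b f\<close> is \<open>n f \<bullet> a\<close>, which changes sign
    under \<open>opp\<close> because the outward normals on the two sides are opposite.\<close>
  also have "(\<Sum>f\<in>UNIV. ?r f (uf f t)) \<le> 0"
    using interfaces W(2) \<kappa> flux_plus[OF t]
    by (intro interface_energy_nonpos[where opp = opp and \<kappa> = \<kappa>])
      (auto simp: matching_interfaces_def)
  finally show "\<exists>E. ((\<lambda>t. mesh_norm_sq (\<lambda>e. M e + Q e) (\<lambda>e. u e t)) has_real_derivative E)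
      (at t within T) \<and> E \<le> 0"
    using deriv by blast
qed

end
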